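(* Let $(a_0,a_1,\dots)$ be an infinite sequence of nonnegative integers containing at most finitely many zeros, let $N$ be such that $a_n>0$ for all $n>N$, and suppose $\prod_{n=N}^{\infty}(1-\lambda_n)>0$. Then $(a_n)$ does not determine a unique point.
   Context: Let $\Delta=\{(x,y)\in\mathbb{R}^2: 1\ge x\ge y>0\}$. For each integer $k\ge 0$ let $\Delta_k=\{(x,y)\in\Delta: 1-x-ky\ge 0> 1-x-(k+1)y\}$. The triangle map is $T(\alpha,\beta)=\left(\frac{\beta}{\alpha},\frac{1-\alpha-k\beta}{\alpha}\right)$ for $(\alpha,\beta)\in\Delta_k$. For nonnegative integers $a_0,\dots,a_n$, $\Delta(a_0,\dots,a_n)=\{(x,y)\in\Delta: T^k(x,y)\in\Delta_{a_k}\text{ for }0\le k\le n\}$ (a triangle). The infinite sequence $(a_n)$ is said to determine a unique point if the diameter of $\Delta(a_0,\dots,a_n)$ tends to $0$ as $n\to\infty$; otherwise it does not determine a unique point (the nested triangles shrink to a nondegenerate line segment). Define $C_{-3}=(1,0,0)$, $C_{-2}=(0,1,0)$, $C_{-1}=(0,0,1)$, $C_k=C_{k-3}-C_{k-2}-a_kC_{k-1}$ ($k\ge0$), $X_k=C_k\times C_{k+1}$ ($k\ge -3$), $X_k=(x_k,y_k,z_k)$. For $V=(a,b,c)$ with $a\ne0$, $\hat V=(b/a,c/a)\in\mathbb{R}^2$; for $V=(a,b,c)$, $W=(d,e,f)$, $V\hat{+}W=\left(\frac{b+e}{a+d},\frac{c+f}{a+d}\right)$. With $d$ the Euclidean distance,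 for $n\ge0$ set $\lambda_n=\dfrac{d(\hat X_{n-1},\hat X_{n+1})}{d(\hat X_{n-1},X_n\hat{+}X_{n-2})}$. *)

theory Defs
  imports "HOL-Analysis.Analysis"
begin

definition tri :: "(real \<times> real) set" where
  "tri = {(x, y). 1 \<ge> x \<and> x \<ge> y \<and> y > 0}"

definition tri_sub :: "nat \<Rightarrow> (real \<times> real) set" where
  "tri_sub k = {(x, y) \<in> tri. 1 - x - real k * y \<ge> 0 \<and> 0 > 1 - x - (real k + 1) * y}"

text \<open>The sets \<open>tri_sub k\<close> partition \<open>tri\<close>, so the index below is well defined on
  \<open>tri\<close>; the value of the map outside \<open>tri\<close> is arbitrary.\<close>

definition tri_map :: "real \<times> real \<Rightarrow> real \<times> real" where
  "tri_map p = (case p of (\<alpha>, \<beta>) \<Rightarrow>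
     let k = (THE k. (\<alpha>, \<beta>) \<in> tri_sub k)
     in (\<beta> / \<alpha>, (1 - \<alpha> - real k * \<beta>) / \<alpha>))"

text \<open>\<open>tri_cell a n\<close> depends only on \<open>a 0, \<dots>, a n\<close>. Membership forces all iterates before the
  last one to lie in \<open>tri\<close>, so the arbitrary values of \<open>tri_map\<close> play no role.\<close>

definition tri_cell :: "(nat \<Rightarrow> nat) \<Rightarrow> nat \<Rightarrow> (real \<times> real) set" where
  "tri_cell a n = {p \<in> tri. \<forall>k\<le>n. (tri_map ^^ k) p \<in> tri_sub (a k)}"

definition determines_unique_point :: "(nat \<Rightarrow> nat) \<Rightarrow> bool" where
  "determines_unique_point a \<longleftrightarrow> (\<lambda>n. diameter (tri_cell a n)) \<longlonglongrightarrow> 0"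

text \<open>The indices start at \<open>-3\<close>; values at smaller indices are irrelevant.\<close>

function tri_C :: "(nat \<Rightarrow> nat) \<Rightarrow> int \<Rightarrow> real ^ 3" where
  "tri_C a k =
     (if k \<le> -3 then vector [1, 0, 0]
      else if k = -2 then vector [0, 1, 0]
      else if k = -1 then vector [0, 0, 1]
      else tri_C a (k - 3) - tri_C a (k - 2) - real (a (nat k)) *\<^sub>R tri_C a (k - 1))"
  by auto
termination by (relation "Wellfounded.measure (\<lambda>(a, k). nat (k + 3))") auto

text \<open>As a rewrite rule the defining equation would loop.\<close>

declare tri_C.simps [simp del]

definition tri_X :: "(nat \<Rightarrow> nat) \<Rightarrow> int \<Rightarrow> real ^ 3" where
  "tri_X a k = cross3 (tri_C a k) (tri_C a (k + 1))"

definition hat :: "real ^ 3 \<Rightarrow> real \<times> real" where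
  "hat V = (V $ 2 / V $ 1, V $ 3 / V $ 1)"

definition hat_plus :: "real ^ 3 \<Rightarrow> real ^ 3 \<Rightarrow> real \<times> real" where
  "hat_plus V W = ((V $ 2 + W $ 2) / (V $ 1 + W $ 1), (V $ 3 + W $ 3) / (V $ 1 + W $ 1))"

text \<open>The distance on \<^typ>\<open>real \<times> real\<close> is the Euclidean one. The first coordinate of
  \<open>tri_X a k\<close> is positive for \<open>k \<ge> -2\<close>, and three consecutive vectors \<open>tri_X a k\<close> are
  linearly independent, so no division by zero occurs here.\<close>

definition tri_lambda :: "(nat \<Rightarrow> nat) \<Rightarrow> nat \<Rightarrow> real" where
  "tri_lambda a n =
     dist (hat (tri_X a (int n - 1))) (hat (tri_X a (int n + 1))) /
     dist (hat (tri_X a (int n - 1)))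
          (hat_plus (tri_X a (int n)) (tri_X a (int n - 2)))"

end

theory Submission imports Defs begin

text \<open>
  By the recurrence for \<open>X\<close>, the point \<open>hat X\<^bsub>n+1\<^esub>\<close> divides the segment from \<open>hat X\<^bsub>n-1\<^esub>\<close> to
  \<open>hat_plus X\<^bsub>n\<^esub> X\<^bsub>n-2\<^esub>\<close> in the ratio given by \<open>\<lambda>\<^bsub>n\<^esub>\<close>, and a positive product of the
  \<open>1 - \<lambda>\<^bsub>n\<^esub>\<close> makes the \<open>\<lambda>\<^bsub>n\<^esub>\<close> summable. The linear functional \<open>C\<^bsub>m-1\<^esub>\<close> vanishes at
  \<open>X\<^bsub>m-2\<^esub>\<close> and \<open>X\<^bsub>m-1\<^esub>\<close> and equals \<open>1\<close> at \<open>X\<^bsub>m\<^esub>\<close>, so the affine function it induces takes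
  values \<open>q\<^bsub>n\<^esub> \<in> [0, c]\<close> at the points \<open>hat X\<^bsub>n\<^esub>\<close>, \<open>n \<ge> m - 2\<close>, where \<open>c = q\<^bsub>m\<^esub> > 0 = q\<^bsub>m-1\<^esub>\<close>.
  Hence \<open>\<bar>q\<^bsub>n+1\<^esub> - q\<^bsub>n-1\<^esub>\<bar> \<le> c \<lambda>\<^bsub>n\<^esub>\<close> for \<open>n \<ge> m\<close>, and if the tail of \<open>\<Sum>\<lambda>\<^bsub>n\<^esub>\<close> from \<open>m\<close> on is
  at most \<open>1/2\<close> then \<open>\<bar>q\<^bsub>n\<^esub> - q\<^bsub>n-1\<^esub>\<bar> \<ge> c/2\<close> for all \<open>n \<ge> m\<close>. So the distance of the vertices
  \<open>hat X\<^bsub>n-1\<^esub>\<close> and \<open>hat X\<^bsub>n\<^esub>\<close> of the \<open>n\<close>-th triangle is bounded away from \<open>0\<close>.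
\<close>

section \<open>Recurrences and pairings of the vectors C_k and X_k\<close>

lemma tri_C_rec:
  "k \<ge> 0 \<Longrightarrow> tri_C a k = tri_C a (k - 3) - tri_C a (k - 2) - real (a (nat k)) *\<^sub>R tri_C a (k - 1)"
  by (subst tri_C.simps) simp

lemma tri_C_init:
  "tri_C a (-3) = vector [1, 0, 0]" "tri_C a (-2) = vector [0, 1, 0]" "tri_C a (-1) = vector [0, 0, 1]"
  by (subst tri_C.simps; simp)+

text \<open>When C_{k+1} is expanded, its multiple of C_k drops out of the cross product; expanding
  C_k in C_k x C_{k-2} then removes C_{k-2}.\<close>

lemma tri_X_rec:
  assumes "k \<ge> 0"
  shows "tri_X a k = tri_X a (k - 1) + real (a (nat k)) *\<^sub>R tri_X a (k - 2) + tri_X a (k - 3)"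
proof -
  have 1: "tri_C a (k + 1) = tri_C a (k - 2) - tri_C a (k - 1) - real (a (nat (k + 1))) *\<^sub>R tri_C a k"
    using tri_C_rec[of "k + 1" a] assms by (simp add: algebra_simps)
  have 2: "tri_C a k = tri_C a (k - 3) - tri_C a (k - 2) - real (a (nat k)) *\<^sub>R tri_C a (k - 1)"
    using tri_C_rec[of k a] assms by simp
  have "tri_X a k = cross3 (tri_C a (k - 1)) (tri_C a k) + cross3 (tri_C a k) (tri_C a (k - 2))"
    unfolding tri_X_def 1
    by (simp add: cross3_simps vec_eq_iff forall_3)
  also have "cross3 (tri_C a k) (tri_C a (k - 2)) =
     cross3 (tri_C a (k - 3)) (tri_C a (k - 2)) + real (a (nat k)) *\<^sub>R cross3 (tri_C a (k - 2)) (tri_C a (k - 1))"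
    unfolding 2 by (simp add: cross3_simps vec_eq_iff forall_3)
  finally show ?thesis by (simp add: tri_X_def)
qed

lemma tri_X_init:
  "tri_X a (-3) = vector [0, 0, 1]" "tri_X a (-2) = vector [1, 0, 0]" "tri_X a (-1) = vector [1, 1, 0]"
  by (simp_all add: tri_X_def tri_C_init tri_C_rec[of 0] cross3_def vec_eq_iff forall_3)

lemma C_dot_X:
  "tri_C a k \<bullet> tri_X a k = 0" "tri_C a (k + 1) \<bullet> tri_X a k = 0"
  by (simp_all add: tri_X_def dot_cross_self)

text \<open>The pairing is the determinant of C_k, C_{k+1}, C_{k+2}. Modulo the last two, C_{k+3}
  equals C_k, and a cyclic shift of three vectors is even.\<close>

lemma C_dot_X_succ:
  assumes "k \<ge> -3"
  shows "tri_C a k \<bullet> tri_X a (k + 1) = 1"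
  using assms
proof (induction rule: int_ge_induct)
  case base
  show ?case
    by (simp add: tri_X_init tri_C_init inner_vec_def sum_3)
next
  case (step k)
  let ?C = "tri_C a"
  have C: "?C (k + 3) = ?C k - ?C (k + 1) - real (a (nat (k + 3))) *\<^sub>R ?C (k + 2)"
    using tri_C_rec[of "k + 3" a] step.hyps by (simp add: add.commute)
  have "?C (k + 1) \<bullet> cross3 (?C (k + 2)) (?C (k + 3)) = ?C k \<bullet> cross3 (?C (k + 1)) (?C (k + 2))"
    unfolding C by (simp add: cross3_def inner_vec_def sum_3 algebra_simps)
  then show ?case
    using step.IH by (simp add: tri_X_def add.assoc)
qed

lemma C_dot_X_pred:
  assumes "k \<ge> -1"
  shows "tri_C a k \<bullet> tri_X a (k - 2) = 1"
  using C_dot_X_succ[of "k - 2" a] assms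
  using C_dot_X[of a] cross_triple[of "tri_C a (k - 2)" "tri_C a (k - 1)" "tri_C a k"]
  by (simp add: tri_X_def inner_commute)

text \<open>All coefficients in the recurrence for X are nonnegative, so a sign condition at three
  consecutive indices propagates upwards.\<close>

lemma inner_tri_X_nonneg:
  assumes "m \<ge> -1" "A \<bullet> tri_X a (m - 2) \<ge> 0" "A \<bullet> tri_X a (m - 1) \<ge> 0" "A \<bullet> tri_X a m \<ge> 0" "k \<ge> m - 2"
  shows "A \<bullet> tri_X a k \<ge> 0"
proof -
  have "A \<bullet> tri_X a (j - 2) \<ge> 0 \<and> A \<bullet> tri_X a (j - 1) \<ge> 0 \<and> A \<bullet> tri_X a j \<ge> 0" if "j \<ge> m" for j
    using that
  proof (induction rule: int_ge_induct)
    case base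
    then show ?case using assms by simp
  next
    case (step j)
    have "tri_X a (j + 1) = tri_X a j + real (a (nat (j + 1))) *\<^sub>R tri_X a (j - 1) + tri_X a (j - 2)"
      using tri_X_rec[of "j + 1" a] step.hyps assms(1) by simp
    then show ?case using step.IH by (simp add: inner_add_right)
  qed
  from this[of "k + 2"] show ?thesis using assms(5) by simp
qed

lemma tri_X_first_nonneg: "k \<ge> -3 \<Longrightarrow> tri_X a k $ 1 \<ge> 0"
  using inner_tri_X_nonneg[of "-1" "axis 1 1" a k]
  by (simp add: inner_axis' tri_X_init)

lemma tri_X_first_ge_1: 
  assumes "k \<ge> -2" 
  shows "tri_X a k $ 1 \<ge> 1"
  using assms
proof (induction rule: int_ge_induct)
  case base
  show ?case by (simp add: tri_X_init)
next
  case (step k)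
  show ?case
  proof (cases "k = -2")
    case True
    then show ?thesis by (simp add: tri_X_init)
  next
    case False
    then have "tri_X a (k + 1) = tri_X a k + real (a (nat (k + 1))) *\<^sub>R tri_X a (k - 1) + tri_X a (k - 2)"
      using tri_X_rec[of "k + 1" a] step.hyps by simp
    moreover have "real (a (nat (k + 1))) * tri_X a (k - 1) $ 1 \<ge> 0" "tri_X a (k - 2) $ 1 \<ge> 0"
      using False step.hyps by (auto intro!: mult_nonneg_nonneg tri_X_first_nonneg)
    ultimately show ?thesis using step.IH by simp
  qed
qed

section \<open>The map in homogeneous coordinates and the vertices of the cells\<close>

lemma tri_map_eq:
  assumes "(x, y) \<in> tri_sub k"
  shows "tri_map (x, y) = (y / x, (1 - x - real k * y) / x)"
proof -
  have "(THE k. (x, y) \<in> tri_sub k) = k"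
  proof (rule the_equality)
    show "(x, y) \<in> tri_sub k" by (rule assms)
  next
    fix l assume l: "(x, y) \<in> tri_sub l"
    then have y: "y > 0" by (simp add: tri_sub_def tri_def)
    have "real l * y < (real k + 1) * y" "real k * y < (real l + 1) * y"
      using l assms by (auto simp: tri_sub_def)
    then have "real l < real k + 1" "real k < real l + 1"
      using y by simp_all
    then show "l = k" by linarith
  qed
  then show ?thesis by (simp add: tri_map_def)
qed

text \<open>Downward induction: by the recurrence C_{k-3} - C_{k-2} = C_k + a_k C_{k-1}, which is
  positive at \<open>V\<close>.\<close>

lemma C_dot_strict_decreasing:
  assumes "k \<le> int n" "k \<ge> -1" "0 < tri_C a n \<bullet> V" "tri_C a n \<bullet> V < tri_C a (int n - 1) \<bullet> V"
    "tri_C a (int n - 1) \<bullet> V < tri_C a (int n - 2) \<bullet> V"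
  shows "0 < tri_C a k \<bullet> V \<and> tri_C a k \<bullet> V < tri_C a (k - 1) \<bullet> V \<and> tri_C a (k - 1) \<bullet> V < tri_C a (k - 2) \<bullet> V"
  using assms(1,2)
proof (induction rule: int_le_induct)
  case base
  show ?case using assms by simp
next
  case (step k)
  have "tri_C a k = tri_C a (k - 3) - tri_C a (k - 2) - real (a (nat k)) *\<^sub>R tri_C a (k - 1)"
    using step.prems by (intro tri_C_rec) simp
  then have "tri_C a k \<bullet> V = tri_C a (k - 3) \<bullet> V - tri_C a (k - 2) \<bullet> V - real (a (nat k)) * (tri_C a (k - 1) \<bullet> V)"
    by (simp add: inner_diff_left)
  moreover have "0 < tri_C a k \<bullet> V" "0 < tri_C a (k - 1) \<bullet> V" 
    using step by simp_all
  moreover have "0 \<le> real (a (nat k)) * (tri_C a (k - 1) \<bullet> V)"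
    using calculation by (intro mult_nonneg_nonneg) simp_all
  ultimately have "tri_C a (k - 2) \<bullet> V < tri_C a (k - 3) \<bullet> V" by linarith
  then show ?case using step by simp
qed

text \<open>In the coordinates f(k) = C_k . V the map is an index shift: the j-th iterate is
  (f(j-2), f(j-1)) / f(j-3), and by the recurrence the inequalities of \<open>tri_sub (a j)\<close>
  become 0 \<le> f(j) < f(j-1).\<close>

lemma hat_mem_tri_cell:
  assumes V: "0 < tri_C a n \<bullet> V" "tri_C a n \<bullet> V < tri_C a (int n - 1) \<bullet> V"
    "tri_C a (int n - 1) \<bullet> V < tri_C a (int n - 2) \<bullet> V"
  shows "hat V \<in> tri_cell a n"
proof -
  define f where "f k = tri_C a k \<bullet> V" for k
  have dec: "0 < f k" "f k < f (k - 1)" "f (k - 1) < f (k - 2)" if "k \<ge> -1" "k \<le> int n" for k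
    using C_dot_strict_decreasing[OF that(2,1) V] by (auto simp: f_def)
  have sub: "(f (int j - 2) / f (int j - 3), f (int j - 1) / f (int j - 3)) \<in> tri_sub (a j)"
    and map: "tri_map (f (int j - 2) / f (int j - 3), f (int j - 1) / f (int j - 3)) =
      (f (int (Suc j) - 2) / f (int (Suc j) - 3), f (int (Suc j) - 1) / f (int (Suc j) - 3))"
    if "j \<le> n" for j
  proof -
    have rec: "f j = f (int j - 3) - f (int j - 2) - real (a j) * f (int j - 1)"
      by (simp add: f_def tri_C_rec[of "int j"] inner_diff_left)
    have pos: "0 < f j" "f j < f (int j - 1)" "f (int j - 1) < f (int j - 2)" "f (int j - 2) < f (int j - 3)"
      using dec[of "int j"] dec[of "int j - 1"] that by simp_all
    show sub: "(f (int j - 2) / f (int j - 3), f (int j - 1) / f (int j - 3)) \<in> tri_sub (a j)"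
      using rec pos by (auto simp: tri_sub_def tri_def field_simps)
    have "1 - f (int j - 2) / f (int j - 3) - real (a j) * (f (int j - 1) / f (int j - 3)) = f j / f (int j - 3)"
      unfolding rec using pos by (simp add: diff_divide_distrib)
    then show "tri_map (f (int j - 2) / f (int j - 3), f (int j - 1) / f (int j - 3)) =
      (f (int (Suc j) - 2) / f (int (Suc j) - 3), f (int (Suc j) - 1) / f (int (Suc j) - 3))"
      unfolding tri_map_eq[OF sub] using pos by simp
  qed
  have hat: "hat V = (f (-2) / f (-3), f (-1) / f (-3))"
    by (simp add: f_def hat_def tri_C_init inner_vec_def sum_3)
  have iter: "(tri_map ^^ j) (hat V) = (f (int j - 2) / f (int j - 3), f (int j - 1) / f (int j - 3))"
    if "j \<le> n" for j
    using that
  proof (induction j)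
    case 0
    then show ?case by (simp add: hat)
  next
    case (Suc j)
    then show ?case using map[of j] by simp
  qed
  have "hat V \<in> tri"
    using sub[of 0] by (auto simp: hat tri_sub_def)
  then show ?thesis
    using iter sub by (auto simp: tri_cell_def)
qed

text \<open>At this combination C_n, C_{n-1}, C_{n-2} take the values r, r + s, r + s + t, the chain
  that \<open>hat_mem_tri_cell\<close> requires.\<close>

lemma hat_combination_mem_tri_cell:
  assumes "r > 0" "s > 0" "t > 0"
  shows "hat (t *\<^sub>R tri_X a (int n - 1) + s *\<^sub>R tri_X a n + r *\<^sub>R (tri_X a n + tri_X a (int n - 2)))
    \<in> tri_cell a n"
proof -
  let ?C = "tri_C a" and ?X = "tri_X a"
  let ?n = "int n"
  have n: "?C ?n \<bullet> ?X (?n - 1) = 0" "?C ?n \<bullet> ?X ?n = 0" "?C ?n \<bullet> ?X (?n - 2) = 1"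
    using C_dot_X[of a ?n] C_dot_X[of a "?n - 1"] C_dot_X_pred[of ?n a] by simp_all
  have n1: "?C (?n - 1) \<bullet> ?X (?n - 1) = 0" "?C (?n - 1) \<bullet> ?X ?n = 1" "?C (?n - 1) \<bullet> ?X (?n - 2) = 0"
    using C_dot_X[of a "?n - 1"] C_dot_X[of a "?n - 2"] C_dot_X_succ[of "?n - 1" a] by simp_all
  have "?C (?n + 1) = ?C (?n - 2) - ?C (?n - 1) - real (a (nat (?n + 1))) *\<^sub>R ?C ?n"
    using tri_C_rec[of "?n + 1" a] by simp
  then have "?C (?n - 2) = ?C (?n + 1) + ?C (?n - 1) + real (a (nat (?n + 1))) *\<^sub>R ?C ?n"
    by (simp add: algebra_simps)
  then have "?C (?n - 2) \<bullet> ?X ?n = 1"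
    using C_dot_X[of a ?n] n1 by (simp add: inner_add_left)
  moreover have "?C (?n - 2) \<bullet> ?X (?n - 1) = 1" "?C (?n - 2) \<bullet> ?X (?n - 2) = 0"
    using C_dot_X[of a "?n - 2"] C_dot_X_succ[of "?n - 2" a] by simp_all
  ultimately show ?thesis
    using assms n n1 by (intro hat_mem_tri_cell) (simp_all add: inner_add_right)
qed

lemma bounded_tri_cell: "bounded (tri_cell a n)"
proof -
  have "tri_cell a n \<subseteq> {0..1} \<times> {0..1}"
    by (auto simp: tri_cell_def tri_def)
  then show ?thesis
    by (rule bounded_subset[rotated]) (intro bounded_Times bounded_closed_interval)
qed

lemma tendsto_hat:
  assumes "(g \<longlongrightarrow> V) F" "V $ 1 \<noteq> 0"
  shows "((\<lambda>x. hat (g x)) \<longlongrightarrow> hat V) F"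
  unfolding hat_def using assms by (intro tendsto_intros) auto

text \<open>The vertices may lie outside the cell, so each is approached by points of the cell:
  combinations whose other two coefficients tend to 0.\<close>

lemma dist_vertices_le_diameter:
  "dist (hat (tri_X a (int n - 1))) (hat (tri_X a n)) \<le> diameter (tri_cell a n)"
proof -
  let ?X = "tri_X a"
  define W where "W = ?X n + ?X (int n - 2)"
  let ?g = "\<lambda>e. ?X (int n - 1) + e *\<^sub>R ?X n + e *\<^sub>R W"
  let ?h = "\<lambda>e. e *\<^sub>R ?X (int n - 1) + ?X n + e *\<^sub>R W"
  have pos: "?X (int n - 1) $ 1 \<noteq> 0" "?X n $ 1 \<noteq> 0"
    using tri_X_first_ge_1[of "int n - 1" a] tri_X_first_ge_1[of "int n" a] by simp_all
  have g: "(?g \<longlongrightarrow> ?X (int n - 1) + 0 *\<^sub>R ?X n + 0 *\<^sub>R W) (at_right 0)"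
    by (intro tendsto_intros)
  have h: "(?h \<longlongrightarrow> 0 *\<^sub>R ?X (int n - 1) + ?X n + 0 *\<^sub>R W) (at_right 0)"
    by (intro tendsto_intros)
  have lim: "((\<lambda>e. dist (hat (?g e)) (hat (?h e))) \<longlongrightarrow>
     dist (hat (?X (int n - 1))) (hat (?X n))) (at_right 0)"
    using g h pos by (intro tendsto_dist tendsto_hat) simp_all
  have "\<forall>\<^sub>F e in at_right 0. dist (hat (?g e)) (hat (?h e)) \<le> diameter (tri_cell a n)"
    using eventually_at_right_less[of 0]
  proof eventually_elim
    case (elim e)
    have "hat (?g e) \<in> tri_cell a n" "hat (?h e) \<in> tri_cell a n"
      using hat_combination_mem_tri_cell[of e e 1 a n] hat_combination_mem_tri_cell[of e 1 e a n] elim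
      by (simp_all add: W_def)
    then show ?case by (rule diameter_bounded_bound[OF bounded_tri_cell])
  qed
  then show ?thesis
    by (intro tendsto_upperbound[OF lim]) simp_all
qed

section \<open>The ratios \<lambda>_n and their summability\<close>

text \<open>The second identity also holds if the denominator of \<open>tri_lambda\<close> vanishes, because then both
  differences are zero.\<close>

lemma tri_lambda_bounds_and_ratio:
  shows tri_lambda_nonneg: "0 \<le> tri_lambda a n"
    and tri_lambda_le_1: "tri_lambda a n \<le> 1"
    and hat_tri_X_diff:
      "hat (tri_X a (int n + 1)) - hat (tri_X a (int n - 1)) =
       tri_lambda a n *\<^sub>R (hat_plus (tri_X a n) (tri_X a (int n - 2)) - hat (tri_X a (int n - 1)))"
proof -
  let ?X = "tri_X a"
  define V W U where "V = ?X (int n - 1)" and "W = ?X n + ?X (int n - 2)" and "U = ?X (int n + 1)"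
  \<comment> \<open>\<open>hat U\<close> is the convex combination of \<open>hat W\<close> and
    \<open>hat V\<close> with weights \<mu> and 1 - \<mu>.\<close>
  define \<mu> where "\<mu> = W $ 1 / U $ 1"
  define b where "b = real (a (Suc n))"
  have U: "U = W + b *\<^sub>R V"
    using tri_X_rec[of "int n + 1" a] by (simp add: U_def V_def W_def b_def nat_add_distrib)
  have pos: "V $ 1 > 0" "W $ 1 > 0" "b \<ge> 0"
    using tri_X_first_ge_1[of "int n - 1" a] tri_X_first_ge_1[of "int n" a] tri_X_first_ge_1[of "int n - 2" a]
    by (auto simp: V_def W_def b_def)
  then have bV: "b * V $ 1 \<ge> 0" by simp
  then have U1: "U $ 1 > 0" using pos by (simp add: U add_pos_nonneg)
  have "W $ 1 \<le> U $ 1" using bV by (simp add: U)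
  then have \<mu>: "0 \<le> \<mu>" "\<mu> \<le> 1"
    using pos U1 by (simp_all add: \<mu>_def)
  have hp: "hat_plus (?X n) (?X (int n - 2)) = hat W"
    by (simp add: hat_plus_def hat_def W_def)
  have "U $ i / U $ 1 - V $ i / V $ 1 = \<mu> * (W $ i / W $ 1 - V $ i / V $ 1)" for i
  proof -
    have "U $ 1 * (V $ 1 * (U $ i / U $ 1 - V $ i / V $ 1)) = U $ i * V $ 1 - U $ 1 * V $ i"
      using pos U1 by (simp add: field_simps)
    also have "\<dots> = W $ i * V $ 1 - W $ 1 * V $ i"
      by (simp add: U algebra_simps)
    also have "\<dots> = U $ 1 * (V $ 1 * (\<mu> * (W $ i / W $ 1 - V $ i / V $ 1)))"
      using pos U1 by (simp add: \<mu>_def field_simps)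
    finally show ?thesis using pos U1 by simp
  qed
  then have diff: "hat U - hat V = \<mu> *\<^sub>R (hat W - hat V)"
    by (simp add: hat_def)
  then have "dist (hat V) (hat U) = \<mu> * dist (hat V) (hat W)"
    using \<mu> by (metis abs_of_nonneg dist_commute dist_norm norm_scaleR)
  \<comment> \<open>For \<open>hat V = hat W\<close> the quotient is 0 / 0, which is 0 by
    convention.\<close>
  then have lam: "tri_lambda a n = (if hat V = hat W then 0 else \<mu>)"
    by (simp add: tri_lambda_def hp flip: V_def U_def)
  show "0 \<le> tri_lambda a n" "tri_lambda a n \<le> 1"
    using \<mu> lam by auto
  show "hat (?X (int n + 1)) - hat (?X (int n - 1)) =
       tri_lambda a n *\<^sub>R (hat_plus (?X n) (?X (int n - 2)) - hat (?X (int n - 1)))"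
    unfolding hp U_def[symmetric] V_def[symmetric] using diff lam by auto
qed

text \<open>The partial products decrease to P, hence stay above it, and 1 - x \<le> exp (-x) turns
  this into the bound -ln P for the partial sums.\<close>

lemma summable_of_has_prod_one_minus:
  fixes f :: "nat \<Rightarrow> real"
  assumes "\<And>n. 0 \<le> f n" "\<And>n. f n \<le> 1" "(\<lambda>n. 1 - f n) has_prod P" "P > 0"
  shows "summable f"
proof (rule bounded_imp_summable)
  fix n
  \<comment> \<open>\<open>has_prod\<close> tolerates finitely many zero factors but then has value
    0, which P > 0 excludes.\<close>
  have lim: "(\<lambda>n. \<Prod>i\<le>n. 1 - f i) \<longlonglongrightarrow> P"
    using assms(3,4) by (auto simp: has_prod_def raw_has_prod_def)
  have "decseq (\<lambda>n. \<Prod>i\<le>n. 1 - f i)"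
    using assms(1,2) by (intro decseq_SucI) (auto intro!: mult_left_le prod_nonneg)
  then have "P \<le> (\<Prod>i\<le>n. 1 - f i)"
    using lim by (rule decseq_ge)
  also have "\<dots> \<le> (\<Prod>i\<le>n. exp (- f i))"
    using assms(2) exp_ge_add_one_self[of "- f _"] by (intro prod_mono) simp
  also have "\<dots> = exp (- (\<Sum>i\<le>n. f i))"
    by (simp add: exp_sum flip: sum_negf)
  finally have "ln P \<le> - (\<Sum>i\<le>n. f i)"
    using assms(4) by (simp add: ln_le_cancel_iff[symmetric] del: ln_le_cancel_iff)
  then show "(\<Sum>i\<le>n. f i) \<le> - ln P" by simp
qed (use assms in auto)

section \<open>Separation of consecutive vertices\<close>

lemma hat_vertices_separated:
  assumes "m \<ge> 1" and tail: "\<And>n. n \<ge> m \<Longrightarrow> (\<Sum>i=m..<n. tri_lambda a i) \<le> 1 / 2"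
  obtains \<delta> where "\<delta> > 0" "\<And>n. n \<ge> m \<Longrightarrow> \<delta> \<le> dist (hat (tri_X a (int n - 1))) (hat (tri_X a n))"
proof -
  let ?X = "tri_X a"
  define A where "A = tri_C a (int m - 1)"
  define c where "c = 1 / ?X m $ 1"
  define L where "L = (A $ 2, A $ 3)"
  define q where "q p = A $ 1 + L \<bullet> p" for p
  have c: "c > 0" using tri_X_first_ge_1[of "int m" a] by (simp add: c_def)
  have A: "A \<bullet> ?X (int m - 2) = 0" "A \<bullet> ?X (int m - 1) = 0" "A \<bullet> ?X m = 1"
    using C_dot_X[of a "int m - 2"] C_dot_X[of a "int m - 1"] C_dot_X_succ[of "int m - 1" a] assms(1)
    by (simp_all add: A_def)
  have q_hat: "q (hat V) = A \<bullet> V / V $ 1" if "V $ 1 > 0" for V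
    using that by (simp add: q_def L_def hat_def inner_vec_def sum_3 add_divide_distrib)
  have lower: "0 \<le> A \<bullet> ?X k" if "k \<ge> int m - 2" for k
    using inner_tri_X_nonneg[of "int m" A a k] A that by simp
  \<comment> \<open>The functional V \<mapsto> c V_1 - A . V is nonnegative at X_{m-2}, X_{m-1} and
    X_m, so its sign propagates like that of \<open>A\<close>.\<close>
  have upper: "A \<bullet> ?X k \<le> c * ?X k $ 1" if "k \<ge> int m - 2" for k
  proof -
    have B: "(c *\<^sub>R axis 1 1 - A) \<bullet> V = c * V $ 1 - A \<bullet> V" for V
      by (simp add: inner_diff_left inner_axis')
    have "0 \<le> c * ?X (int m - 2) $ 1" "0 \<le> c * ?X (int m - 1) $ 1" "c * ?X m $ 1 = 1"
      using c tri_X_first_ge_1[of "int m - 2" a] tri_X_first_ge_1[of "int m - 1" a]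
        tri_X_first_ge_1[of "int m" a] assms(1)
      by (simp_all add: c_def)
    then show ?thesis
      using inner_tri_X_nonneg[of "int m" "c *\<^sub>R axis 1 1 - A" a k] A that by (simp add: B)
  qed
  have q_step: "\<bar>q (hat (?X (int n + 1))) - q (hat (?X (int n - 1)))\<bar> \<le> c * tri_lambda a n" if "n \<ge> m" for n
  proof -
    define W where "W = ?X n + ?X (int n - 2)"
    have hp: "hat_plus (?X n) (?X (int n - 2)) = hat W"
      by (simp add: hat_plus_def hat_def W_def)
    have X1: "?X n $ 1 \<ge> 1" "?X (int n - 1) $ 1 \<ge> 1" "?X (int n - 2) $ 1 \<ge> 1"
      using that assms(1) by (simp_all add: tri_X_first_ge_1)
    then have W1: "W $ 1 > 0" by (simp add: W_def)
    have "0 \<le> A \<bullet> W" "A \<bullet> W \<le> c * W $ 1"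
      using lower[of n] lower[of "int n - 2"] upper[of n] upper[of "int n - 2"] that
      by (simp_all add: W_def inner_add_right distrib_left)
    then have qW: "0 \<le> q (hat W)" "q (hat W) \<le> c"
      using W1 by (simp_all add: q_hat divide_le_eq)
    have qV: "0 \<le> q (hat (?X (int n - 1)))" "q (hat (?X (int n - 1))) \<le> c"
      using lower[of "int n - 1"] upper[of "int n - 1"] X1 that by (simp_all add: q_hat divide_le_eq)
    have "q (hat (?X (int n + 1))) - q (hat (?X (int n - 1))) =
      L \<bullet> (hat (?X (int n + 1)) - hat (?X (int n - 1)))"
      by (simp add: q_def inner_diff_right)
    also have "\<dots> = tri_lambda a n * (q (hat W) - q (hat (?X (int n - 1))))"
      unfolding hat_tri_X_diff hp by (simp add: q_def inner_diff_right)
    also have "\<bar>\<dots>\<bar> \<le> tri_lambda a n * c"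
      unfolding abs_mult using qW qV tri_lambda_nonneg[of a n] by (intro mult_mono) auto
    finally show ?thesis by (simp add: mult.commute)
  qed
  \<comment> \<open>The gap starts as q_m - q_{m-1} = c. Replacing q_{n-1} by q_{n+1} changes its
    distance to q_n by at most c \<lambda>_n.\<close>
  have sep: "c * (1 - (\<Sum>i=m..<n. tri_lambda a i)) \<le> \<bar>q (hat (?X n)) - q (hat (?X (int n - 1)))\<bar>"
    if "n \<ge> m" for n
    using that
  proof (induction n rule: dec_induct)
    case base
    then show ?case
      using A tri_X_first_ge_1[of "int m" a] tri_X_first_ge_1[of "int m - 1" a] c assms(1)
      by (simp add: q_hat c_def)
  next
    case (step n)
    have "c * (1 - (\<Sum>i=m..<Suc n. tri_lambda a i)) =
      c * (1 - (\<Sum>i=m..<n. tri_lambda a i)) - c * tri_lambda a n"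
      using step.hyps by (simp add: algebra_simps)
    moreover have "int (Suc n) = int n + 1" "int n + 1 - 1 = int n" by simp_all
    ultimately show ?case
      using step.IH q_step[OF step.hyps(1)] by (simp only:)
  qed
  show thesis
  proof
    \<comment> \<open>By Cauchy-Schwarz c / 2 is at most \<open>norm L\<close> times the distance;
      the extra 1 keeps the divisor positive even for L = 0.\<close>
    show "c / 2 / (norm L + 1) > 0"
      using c norm_ge_zero[of L] by (intro divide_pos_pos) linarith+
    fix n assume n: "n \<ge> m"
    let ?d = "dist (hat (?X (int n - 1))) (hat (?X n))"
    have "c / 2 \<le> c * (1 - (\<Sum>i=m..<n. tri_lambda a i))"
      using mult_left_mono[of "1 / 2" "1 - (\<Sum>i=m..<n. tri_lambda a i)" c] tail[OF n] c by simp
    also have "\<dots> \<le> \<bar>L \<bullet> (hat (?X n) - hat (?X (int n - 1)))\<bar>"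
      using sep[OF n] by (simp add: q_def inner_diff_right)
    also have "\<dots> \<le> norm L * ?d"
      using Cauchy_Schwarz_ineq2[of L] by (simp add: dist_norm norm_minus_commute)
    also have "\<dots> \<le> ?d * (norm L + 1)"
      by (simp add: algebra_simps)
    finally show "c / 2 / (norm L + 1) \<le> ?d"
      using norm_ge_zero[of L] by (subst pos_divide_le_eq) linarith+
  qed
qed

theorem theorem12:
  fixes a :: "nat \<Rightarrow> nat" and N :: nat and P :: real
  assumes "finite {n. a n = 0}"
    and "\<forall>n>N. a n > 0"
    and "(\<lambda>n. 1 - tri_lambda a (N + n)) has_prod P"
    and "P > 0"
  shows "\<not> determines_unique_point a"
proof
  assume "determines_unique_point a"
  then have lim: "(\<lambda>n. diameter (tri_cell a n)) \<longlonglongrightarrow> 0"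
    by (simp add: determines_unique_point_def)
  have "summable (\<lambda>n. tri_lambda a (N + n))"
    using assms(3,4) by (intro summable_of_has_prod_one_minus tri_lambda_nonneg tri_lambda_le_1)
  then have "summable (\<lambda>n. tri_lambda a (n + N))"
    by (simp only: add.commute)
  then have "summable (tri_lambda a)"
    by (rule summable_iff_shift[THEN iffD1])
  then obtain M where M: "\<And>m n. m \<ge> M \<Longrightarrow> norm (\<Sum>i=m..<n. tri_lambda a i) < 1 / 2"
    unfolding summable_Cauchy by (meson half_gt_zero zero_less_one)
  \<comment> \<open>Starting at \<open>Suc M\<close> makes the index at least 1, as
    \<open>hat_vertices_separated\<close> requires.\<close>
  have tail: "(\<Sum>i=Suc M..<n. tri_lambda a i) \<le> 1 / 2" if "n \<ge> Suc M" for n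
    using M[of "Suc M" n] by (simp only: real_norm_def) linarith
  obtain \<delta> where \<delta>: "\<delta> > 0"
    "\<And>n. n \<ge> Suc M \<Longrightarrow> \<delta> \<le> dist (hat (tri_X a (int n - 1))) (hat (tri_X a n))"
    by (rule hat_vertices_separated[of "Suc M" a]) (simp, erule tail, rule that)
  have "\<delta> \<le> diameter (tri_cell a n)" if "n \<ge> Suc M" for n
    using \<delta>(2)[OF that] dist_vertices_le_diameter by (rule order_trans)
  then have "\<forall>\<^sub>F n in sequentially. \<delta> \<le> diameter (tri_cell a n)"
    by (rule eventually_sequentiallyI)
  then have "\<delta> \<le> 0"
    using tendsto_lowerbound[OF lim] by simp
  with \<delta>(1) show False by simp
qed

end
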